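(* Let $A_{\alpha_A}=(A,[-,-],[-,-,-],\varepsilon,\alpha_A)$ be a color Hom-Akivis algebra and $\beta:A\to A$ an even endomorphism. Then, for any integer $n\ge 1$, $$A_{\beta^n}=(A,[-,-]_{\beta^n},[-,-,-]_{\beta^n},\varepsilon,\beta^n\circ\alpha_A)$$ is a color Hom-Akivis algebra, where for all $x,y,z\in\mathcal H(A)$ $$[x,y]_{\beta^n}:=\beta^n([x,y]),\qquad [x,y,z]_{\beta^n}:=\beta^{2n}([x,y,z]).$$ Moreover, if $A_{\alpha_A}$ is multiplicative and $\beta$ commutes with $\alpha_A$, then $A_{\beta^n}$ is multiplicative.
   Context: $\mathbf K$ is a field of characteristic $0$ and $G$ is an abelian group (written additively). For a $G$-graded vector space $V=\bigoplus_{a\in G}V_a$, $\mathcal H(V)$ is the set of homogeneous elements. A linear (or multilinear) map is even if it preserves degrees. A bicharacter is a map $\varepsilon:G\times G\to\mathbf K^*$ with $\varepsilon(a,b)\varepsilon(b,a)=1$, $\varepsilon(a,b+c)=\varepsilon(a,b)\varepsilon(a,c)$, $\varepsilon(a+b,c)=\varepsilon(a,c)\varepsilon(b,c)$. For homogeneous $x,y$ of degrees $a,b$ one writes $\varepsilon(x,y):=\varepsilon(a,b)$. A color Hom-Akivis algebra is a quintuple $(A,[-,-],[-,-,-],\varepsilon,\alpha_A)$ consisting of a $G$-graded vector space $A$, a bicharacter $\varepsilon$, an even bilinear map $[-,-]$ that is $\varepsilon$-skew-symmetric ($[x,y]=-\varepsilon(x,y)[y,x]$ for homogeneous $x,y$),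 an even trilinear map $[-,-,-]$, and an even linear map $\alpha_A:A\to A$ such that for all $x,y,z\in\mathcal H(A)$ $$\oint\varepsilon(z,x)[[x,y],\alpha_A(z)]=\oint\varepsilon(z,x)\big([x,y,z]-\varepsilon(x,y)[y,x,z]\big),$$ where $\oint$ denotes the sum over cyclic permutations of $x,y,z$. It is multiplicative if in addition $\alpha_A([x,y])=[\alpha_A(x),\alpha_A(y)]$ and $\alpha_A([x,y,z])=[\alpha_A(x),\alpha_A(y),\alpha_A(z)]$. An even endomorphism $\beta$ of a color Hom-Akivis algebra is an even linear map $\beta:A\to A$ with $\beta([x,y])=[\beta(x),\beta(y)]$ and $\beta([x,y,z])=[\beta(x),\beta(y),\beta(z)]$ (commutation with $\alpha_A$ is not required). *)

theory Defs
  imports Complex_Main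
begin

text \<open>
  The underlying vector space is the whole type \<open>'a\<close> with scalar multiplication \<open>scale\<close>;
  \<open>A g\<close> is the homogeneous component of degree \<open>g\<close>, so the homogeneous elements are those
  lying in some \<open>A g\<close>.
\<close>

locale graded_vector_space = vector_space scale
  for scale :: "'k::field_char_0 \<Rightarrow> 'a::ab_group_add \<Rightarrow> 'a" +
  fixes A :: "'g::ab_group_add \<Rightarrow> 'a set"
  assumes component_subspace: "subspace (A g)"
    and direct_sum: "\<exists>!f. (\<forall>g. f g \<in> A g) \<and> finite {g. f g \<noteq> 0} \<and> x = (\<Sum>g | f g \<noteq> 0. f g)"

definition bicharacter :: "('g::ab_group_add \<Rightarrow> 'g \<Rightarrow> 'k::field) \<Rightarrow> bool" where
  "bicharacter \<epsilon> \<longleftrightarrow>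
     (\<forall>a b. \<epsilon> a b \<noteq> 0) \<and>
     (\<forall>a b. \<epsilon> a b * \<epsilon> b a = 1) \<and>
     (\<forall>a b c. \<epsilon> a (b + c) = \<epsilon> a b * \<epsilon> a c) \<and>
     (\<forall>a b c. \<epsilon> (a + b) c = \<epsilon> a c * \<epsilon> b c)"

definition even_linear ::
  "('k::field \<Rightarrow> 'a::ab_group_add \<Rightarrow> 'a) \<Rightarrow> ('g \<Rightarrow> 'a set) \<Rightarrow> ('a \<Rightarrow> 'a) \<Rightarrow> bool" where
  "even_linear scale A f \<longleftrightarrow>
     Vector_Spaces.linear scale scale f \<and> (\<forall>a. \<forall>x\<in>A a. f x \<in> A a)"

definition even_bilinear ::
  "('k::field \<Rightarrow> 'a::ab_group_add \<Rightarrow> 'a) \<Rightarrow> ('g::ab_group_add \<Rightarrow> 'a set) \<Rightarrow>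
   ('a \<Rightarrow> 'a \<Rightarrow> 'a) \<Rightarrow> bool" where
  "even_bilinear scale A m \<longleftrightarrow>
     (\<forall>y. Vector_Spaces.linear scale scale (\<lambda>x. m x y)) \<and>
     (\<forall>x. Vector_Spaces.linear scale scale (\<lambda>y. m x y)) \<and>
     (\<forall>a b. \<forall>x\<in>A a. \<forall>y\<in>A b. m x y \<in> A (a + b))"

definition even_trilinear ::
  "('k::field \<Rightarrow> 'a::ab_group_add \<Rightarrow> 'a) \<Rightarrow> ('g::ab_group_add \<Rightarrow> 'a set) \<Rightarrow>
   ('a \<Rightarrow> 'a \<Rightarrow> 'a \<Rightarrow> 'a) \<Rightarrow> bool" where
  "even_trilinear scale A t \<longleftrightarrow>
     (\<forall>y z. Vector_Spaces.linear scale scale (\<lambda>x. t x y z)) \<and>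
     (\<forall>x z. Vector_Spaces.linear scale scale (\<lambda>y. t x y z)) \<and>
     (\<forall>x y. Vector_Spaces.linear scale scale (\<lambda>z. t x y z)) \<and>
     (\<forall>a b c. \<forall>x\<in>A a. \<forall>y\<in>A b. \<forall>z\<in>A c. t x y z \<in> A (a + b + c))"

text \<open>
  The sign \<open>\<epsilon>(x,y)\<close> of homogeneous elements is rendered as \<open>\<epsilon> a b\<close> for all degrees \<open>a\<close>, \<open>b\<close>
  with \<open>x \<in> A a\<close>, \<open>y \<in> A b\<close>. Only \<open>0\<close> has more than one degree, and then all terms vanish.
\<close>

locale color_hom_akivis_algebra = graded_vector_space scale A
  for scale :: "'k::field_char_0 \<Rightarrow> 'a::ab_group_add \<Rightarrow> 'a"
    and A :: "'g::ab_group_add \<Rightarrow> 'a set" +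
  fixes br :: "'a \<Rightarrow> 'a \<Rightarrow> 'a"
    and tr :: "'a \<Rightarrow> 'a \<Rightarrow> 'a \<Rightarrow> 'a"
    and \<epsilon> :: "'g \<Rightarrow> 'g \<Rightarrow> 'k"
    and \<alpha> :: "'a \<Rightarrow> 'a"
  assumes bichar: "bicharacter \<epsilon>"
    and br_even_bilinear: "even_bilinear scale A br"
    and br_skew: "\<lbrakk>x \<in> A a; y \<in> A b\<rbrakk> \<Longrightarrow> br x y = - scale (\<epsilon> a b) (br y x)"
    and tr_even_trilinear: "even_trilinear scale A tr"
    and twist_even_linear: "even_linear scale A \<alpha>"
    and hom_akivis_identity: "\<lbrakk>x \<in> A a; y \<in> A b; z \<in> A c\<rbrakk> \<Longrightarrow>
          scale (\<epsilon> c a) (br (br x y) (\<alpha> z))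
        + scale (\<epsilon> a b) (br (br y z) (\<alpha> x))
        + scale (\<epsilon> b c) (br (br z x) (\<alpha> y))
        = scale (\<epsilon> c a) (tr x y z - scale (\<epsilon> a b) (tr y x z))
        + scale (\<epsilon> a b) (tr y z x - scale (\<epsilon> b c) (tr z y x))
        + scale (\<epsilon> b c) (tr z x y - scale (\<epsilon> c a) (tr x z y))"

locale multiplicative_color_hom_akivis_algebra = color_hom_akivis_algebra scale A br tr \<epsilon> \<alpha>
  for scale :: "'k::field_char_0 \<Rightarrow> 'a::ab_group_add \<Rightarrow> 'a"
    and A :: "'g::ab_group_add \<Rightarrow> 'a set"
    and br tr \<epsilon> \<alpha> +
  assumes twist_br: "\<alpha> (br x y) = br (\<alpha> x) (\<alpha> y)"
    and twist_tr: "\<alpha> (tr x y z) = tr (\<alpha> x) (\<alpha> y) (\<alpha> z)"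

definition even_endomorphism ::
  "('k::field \<Rightarrow> 'a::ab_group_add \<Rightarrow> 'a) \<Rightarrow> ('g \<Rightarrow> 'a set) \<Rightarrow>
   ('a \<Rightarrow> 'a \<Rightarrow> 'a) \<Rightarrow> ('a \<Rightarrow> 'a \<Rightarrow> 'a \<Rightarrow> 'a) \<Rightarrow> ('a \<Rightarrow> 'a) \<Rightarrow> bool" where
  "even_endomorphism scale A br tr \<beta> \<longleftrightarrow>
     even_linear scale A \<beta> \<and>
     (\<forall>x y. \<beta> (br x y) = br (\<beta> x) (\<beta> y)) \<and>
     (\<forall>x y z. \<beta> (tr x y z) = tr (\<beta> x) (\<beta> y) (\<beta> z))"

end

theory Submission imports Defs begin

text \<open>
  An even endomorphism \<open>\<gamma>\<close> pulls out of a twisted double bracket twice: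
  \<open>\<gamma> [\<gamma> [x, y], \<gamma> (\<alpha> z)] = \<gamma>\<^sup>2 [[x, y], \<alpha> z]\<close>. So the Hom-Akivis identity of the twisted algebra
  is the image under \<open>\<gamma>\<^sup>2\<close> of the original one. Powers of even endomorphisms are again even
  endomorphisms, and the theorem is the case \<open>\<gamma> = \<beta>\<^sup>n\<close>.
\<close>

text \<open>\<open>Vector_Spaces.linear\<close> includes the vector space axioms. Composites inherit
  them from their factors, but for \<open>id\<close> they have to be assumed.\<close>

lemma even_linear_id:
  assumes "vector_space scale"
  shows "even_linear scale A id"
  using vector_space.linear_id[OF assms] unfolding even_linear_def by simp

lemma even_linear_comp:
  assumes "even_linear scale A f" "even_linear scale A g"
  shows "even_linear scale A (f \<circ> g)"
  using assms unfolding even_linear_def by (auto intro: Vector_Spaces.linear_compose)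

lemma even_bilinear_comp:
  assumes "even_linear scale A f" "even_bilinear scale A m"
  shows "even_bilinear scale A (\<lambda>x y. f (m x y))"
  \<comment> \<open>Fixing only the outer map \<open>f\<close> leaves the inner map schematic, so
    one instance serves both slots.\<close>
  using assms Vector_Spaces.linear_compose[of scale scale _ scale f]
  unfolding even_linear_def even_bilinear_def o_def by simp

lemma even_trilinear_comp:
  assumes "even_linear scale A f" "even_trilinear scale A t"
  shows "even_trilinear scale A (\<lambda>x y z. f (t x y z))"
  using assms Vector_Spaces.linear_compose[of scale scale _ scale f]
  unfolding even_linear_def even_trilinear_def o_def by simp

lemma even_endomorphism_funpow:
  assumes "vector_space scale" "even_endomorphism scale A br tr \<beta>"
  shows "even_endomorphism scale A br tr (\<beta> ^^ n)"
proof (induction n)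
  case 0
  show ?case
    using even_linear_id[OF assms(1)] by (simp add: even_endomorphism_def id_def)
next
  case (Suc n)
  then show ?case
    using assms(2) even_linear_comp[of scale A \<beta> "\<beta> ^^ n"]
    by (simp add: even_endomorphism_def o_def)
qed

context color_hom_akivis_algebra
begin

text \<open>The double bracket collects two copies of \<open>\<gamma>\<close>, so the ternary
  product must be twisted by \<open>\<gamma>\<close> twice. The signs stay the same because
  \<open>\<gamma>\<close> acts linearly and preserves degrees.\<close>

lemma twist_by_endomorphism:
  assumes "even_endomorphism scale A br tr \<gamma>"
  shows "color_hom_akivis_algebra scale A
           (\<lambda>x y. \<gamma> (br x y)) (\<lambda>x y z. \<gamma> (\<gamma> (tr x y z))) \<epsilon> (\<gamma> \<circ> \<alpha>)"
proof -
  have even: "even_linear scale A \<gamma>" and hom: "\<And>x y. \<gamma> (br x y) = br (\<gamma> x) (\<gamma> y)"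
    using assms unfolding even_endomorphism_def by auto
  then interpret \<gamma>: Vector_Spaces.linear scale scale \<gamma>
    unfolding even_linear_def by simp
  show ?thesis
  proof
    show "bicharacter \<epsilon>"
      by (fact bichar)
    show "even_bilinear scale A (\<lambda>x y. \<gamma> (br x y))"
      by (rule even_bilinear_comp[OF even br_even_bilinear])
    show "even_trilinear scale A (\<lambda>x y z. \<gamma> (\<gamma> (tr x y z)))"
      by (rule even_trilinear_comp[OF even even_trilinear_comp[OF even tr_even_trilinear]])
    show "even_linear scale A (\<gamma> \<circ> \<alpha>)"
      by (rule even_linear_comp[OF even twist_even_linear])
    show "\<gamma> (br x y) = - scale (\<epsilon> a b) (\<gamma> (br y x))" if "x \<in> A a" "y \<in> A b" for x y a b
      using arg_cong[OF br_skew[OF that], of \<gamma>] by (simp only: \<gamma>.neg \<gamma>.scale)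
    show "scale (\<epsilon> c a) (\<gamma> (br (\<gamma> (br x y)) ((\<gamma> \<circ> \<alpha>) z)))
        + scale (\<epsilon> a b) (\<gamma> (br (\<gamma> (br y z)) ((\<gamma> \<circ> \<alpha>) x)))
        + scale (\<epsilon> b c) (\<gamma> (br (\<gamma> (br z x)) ((\<gamma> \<circ> \<alpha>) y)))
        = scale (\<epsilon> c a) (\<gamma> (\<gamma> (tr x y z)) - scale (\<epsilon> a b) (\<gamma> (\<gamma> (tr y x z))))
        + scale (\<epsilon> a b) (\<gamma> (\<gamma> (tr y z x)) - scale (\<epsilon> b c) (\<gamma> (\<gamma> (tr z y x))))
        + scale (\<epsilon> b c) (\<gamma> (\<gamma> (tr z x y)) - scale (\<epsilon> c a) (\<gamma> (\<gamma> (tr x z y))))"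
      if "x \<in> A a" "y \<in> A b" "z \<in> A c" for x y z a b c
      \<comment> \<open>Here \<open>hom\<close> covers only \<open>br\<close>: it drives every
        \<open>\<gamma>\<close> down to the arguments of the double brackets, where both versions
        agree, while the \<open>tr\<close> terms already match as they stand.\<close>
      using arg_cong[OF hom_akivis_identity[OF that], of "\<lambda>u. \<gamma> (\<gamma> u)"]
      by (simp only: \<gamma>.add \<gamma>.diff \<gamma>.scale hom o_apply)
  qed
qed

end

lemma (in multiplicative_color_hom_akivis_algebra) multiplicative_twist_by_endomorphism:
  assumes endo: "even_endomorphism scale A br tr \<gamma>" and comm: "\<gamma> \<circ> \<alpha> = \<alpha> \<circ> \<gamma>"
  shows "multiplicative_color_hom_akivis_algebra scale A
           (\<lambda>x y. \<gamma> (br x y)) (\<lambda>x y z. \<gamma> (\<gamma> (tr x y z))) \<epsilon> (\<gamma> \<circ> \<alpha>)"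
proof -
  have hom: "\<gamma> (br x y) = br (\<gamma> x) (\<gamma> y)" "\<gamma> (tr x y z) = tr (\<gamma> x) (\<gamma> y) (\<gamma> z)" for x y z
    using endo unfolding even_endomorphism_def by auto
  \<comment> \<open>Oriented to move \<open>\<alpha>\<close> inward: with \<open>hom\<close>,
    \<open>twist_br\<close> and \<open>twist_tr\<close>, both sides of each multiplicativity law
    become a product of arguments of the form \<open>\<gamma> (\<gamma> (\<alpha> x))\<close>, with
    three copies of \<open>\<gamma>\<close> for \<open>tr\<close>.\<close>
  have "\<alpha> (\<gamma> x) = \<gamma> (\<alpha> x)" for x
    using fun_cong[OF comm, of x] by simp
  then show ?thesis
    by (intro multiplicative_color_hom_akivis_algebra.intro twist_by_endomorphism[OF endo]
        multiplicative_color_hom_akivis_algebra_axioms.intro)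
      (simp_all add: hom twist_br twist_tr)
qed

lemma funpow_comp_commute:
  assumes "f \<circ> g = g \<circ> f"
  shows "(f ^^ n) \<circ> g = g \<circ> (f ^^ n)"
  using assms by (induction n) (simp_all add: fun_eq_iff)

theorem theorem3p2:
  fixes scale :: "'k::field_char_0 \<Rightarrow> 'a::ab_group_add \<Rightarrow> 'a"
    and A :: "'g::ab_group_add \<Rightarrow> 'a set"
    and br :: "'a \<Rightarrow> 'a \<Rightarrow> 'a"
    and tr :: "'a \<Rightarrow> 'a \<Rightarrow> 'a \<Rightarrow> 'a"
    and \<epsilon> :: "'g \<Rightarrow> 'g \<Rightarrow> 'k"
    and \<alpha> \<beta> :: "'a \<Rightarrow> 'a"
    and n :: nat
  assumes "color_hom_akivis_algebra scale A br tr \<epsilon> \<alpha>"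
    and "even_endomorphism scale A br tr \<beta>"
    and "n \<ge> 1"
  shows "color_hom_akivis_algebra scale A
           (\<lambda>x y. (\<beta> ^^ n) (br x y)) (\<lambda>x y z. (\<beta> ^^ (2 * n)) (tr x y z)) \<epsilon> ((\<beta> ^^ n) \<circ> \<alpha>)
       \<and> (multiplicative_color_hom_akivis_algebra scale A br tr \<epsilon> \<alpha> \<and> \<beta> \<circ> \<alpha> = \<alpha> \<circ> \<beta> \<longrightarrow>
            multiplicative_color_hom_akivis_algebra scale A
              (\<lambda>x y. (\<beta> ^^ n) (br x y)) (\<lambda>x y z. (\<beta> ^^ (2 * n)) (tr x y z)) \<epsilon> ((\<beta> ^^ n) \<circ> \<alpha>))"
proof -
  interpret color_hom_akivis_algebra scale A br tr \<epsilon> \<alpha>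
    by fact
  have endo: "even_endomorphism scale A br tr (\<beta> ^^ n)"
    using vector_space_axioms assms(2) by (rule even_endomorphism_funpow)
  \<comment> \<open>Brings the ternary twist into the nested form
    \<open>\<gamma> (\<gamma> (tr x y z))\<close> with \<open>\<gamma>\<close> equal to
    \<open>\<beta> ^^ n\<close>.\<close>
  have "\<beta> ^^ (2 * n) = (\<beta> ^^ n) \<circ> (\<beta> ^^ n)"
    by (simp add: mult_2 funpow_add)
  then show ?thesis
    \<comment> \<open>Multiplicativity is only the antecedent of the second claim, so that premise
      is left open by \<open>_\<close> in the second fact.\<close>
    using twist_by_endomorphism[OF endo]
      multiplicative_color_hom_akivis_algebra.multiplicative_twist_by_endomorphism
        [OF _ endo funpow_comp_commute]
    by (simp only: o_apply) blast
qed

end
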